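(* Let $\mathcal{A}$ be a Banach algebra, let $a,b\in\mathcal{A}$, and suppose $a\in\mathrm{comm}^2(b)$. (i) If $a$ has the Drazin inverse $x$ and $b$ has a left (resp. right) Drazin inverse $y$, then $yx$ is a left (resp. right) Drazin inverse of $ab$. (ii) If $a$ has the generalized Drazin inverse $x$ and $b$ has a left (resp. right) generalized Drazin inverse $y$, then $yx$ is a left (resp. right) generalized Drazin inverse of $ab$.
   Context: $\mathcal{A}$ is a Banach algebra, $r(\cdot)$ denotes the spectral radius, and $\mathcal{A}^{qnil}=\{c\in\mathcal{A}: r(c)=0\}$ is the set of quasi-nilpotent elements. For $c\in\mathcal{A}$, $\mathrm{comm}(c)=\{z\in\mathcal{A}: zc=cz\}$ and $\mathrm{comm}^2(c)=\{z\in\mathcal{A}: zw=wz \text{ for all } w\in\mathrm{comm}(c)\}$. Let $c\in\mathcal{A}$. - $x\in\mathcal{A}$ is the Drazin inverse of $c$ if $cx=xc$, $x^2c=x$ and $c^{j+1}x=c^j$ for some non-negative integer $j$. - $x\in\mathcal{A}$ is the generalized Drazin inverse of $c$ if $cx=xc$, $x^2c=x$ and $c-cxc\in\mathcal{A}^{qnil}$. - $x\in\mathcal{A}$ is a left Drazin inverse of $c$ if $cxc=xc^2$, $x^2c=x$ and $xc^{j+1}=c^j$ for some non-negative integer $j$. - $y\in\mathcal{A}$ is a right Drazin inverse of $c$ if $cyc=c^2y$, $cy^2=y$ and $c^{j+1}y=c^j$ for some non-negative integer $j$. - $x\in\mathcal{A}$ is a left generalized Drazin inverse of $c$ if $cxc=xc^2$,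 $x^2c=x$ and $cxc-c\in\mathcal{A}^{qnil}$. - $y\in\mathcal{A}$ is a right generalized Drazin inverse of $c$ if $cyc=c^2y$, $cy^2=y$ and $cyc-c\in\mathcal{A}^{qnil}$.
   Formalization: In the right cases of (i) and (ii) the product proved to be a right (generalized) Drazin inverse of ab is xy, not yx as printed; the printed right claim is false (a counterexample exists on C ⊕ l^2). The left cases are as printed. *)

theory Defs
  imports "HOL-Analysis.Analysis"
begin

text \<open>
  Unital complex Banach algebras: the library classes only provide real scalars; the complex
  scalar multiplication added here restricts to the real one on real scalars. Together with
  \<open>real_normed_algebra_1\<close> this gives a nonzero complex algebra with a complete
  submultiplicative norm and a unit of norm 1.
\<close>

class complex_banach_algebra_1 = real_normed_algebra_1 + banach +
  fixes scaleC :: "complex \<Rightarrow> 'a \<Rightarrow> 'a"  (infixr "*\<^sub>C" 75)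
  assumes scaleC_add_right: "z *\<^sub>C (x + y) = z *\<^sub>C x + z *\<^sub>C y"
    and scaleC_add_left: "(z + w) *\<^sub>C x = z *\<^sub>C x + w *\<^sub>C x"
    and scaleC_scaleC: "z *\<^sub>C (w *\<^sub>C x) = (z * w) *\<^sub>C x"
    and scaleC_of_real: "complex_of_real r *\<^sub>C x = r *\<^sub>R x"
    and mult_scaleC_left: "(z *\<^sub>C x) * y = z *\<^sub>C (x * y)"
    and mult_scaleC_right: "x * (z *\<^sub>C y) = z *\<^sub>C (x * y)"
    and norm_scaleC: "norm (z *\<^sub>C x) = cmod z * norm x"

instantiation complex :: complex_banach_algebra_1
begin

definition scaleC_complex :: "complex \<Rightarrow> complex \<Rightarrow> complex" where
  "scaleC_complex z x = z * x"

instance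
  by standard (simp_all add: scaleC_complex_def algebra_simps norm_mult scaleR_conv_of_real)

end

definition spectrum :: "'a::complex_banach_algebra_1 \<Rightarrow> complex set" where
  "spectrum c = {z. \<not> (\<exists>u. (z *\<^sub>C 1 - c) * u = 1 \<and> u * (z *\<^sub>C 1 - c) = 1)}"

text \<open>
  The spectrum is nonempty and bounded, so the supremum of reals below never takes an
  unspecified value.
\<close>

definition spectral_radius :: "'a::complex_banach_algebra_1 \<Rightarrow> real" where
  "spectral_radius c = (SUP z\<in>spectrum c. cmod z)"

definition qnil :: "'a::complex_banach_algebra_1 set" where
  "qnil = {c. spectral_radius c = 0}"

definition comm :: "'a::complex_banach_algebra_1 \<Rightarrow> 'a set" where
  "comm c = {z. z * c = c * z}"

definition comm2 :: "'a::complex_banach_algebra_1 \<Rightarrow> 'a set" where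
  "comm2 c = {z. \<forall>w\<in>comm c. z * w = w * z}"

definition is_drazin_inverse :: "'a::complex_banach_algebra_1 \<Rightarrow> 'a \<Rightarrow> bool" where
  "is_drazin_inverse c x \<longleftrightarrow>
     c * x = x * c \<and> x^2 * c = x \<and> (\<exists>j::nat. c^(j + 1) * x = c^j)"

definition is_gen_drazin_inverse :: "'a::complex_banach_algebra_1 \<Rightarrow> 'a \<Rightarrow> bool" where
  "is_gen_drazin_inverse c x \<longleftrightarrow>
     c * x = x * c \<and> x^2 * c = x \<and> c - c * x * c \<in> qnil"

definition is_left_drazin_inverse :: "'a::complex_banach_algebra_1 \<Rightarrow> 'a \<Rightarrow> bool" where
  "is_left_drazin_inverse c x \<longleftrightarrow>
     c * x * c = x * c^2 \<and> x^2 * c = x \<and> (\<exists>j::nat. x * c^(j + 1) = c^j)"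

definition is_right_drazin_inverse :: "'a::complex_banach_algebra_1 \<Rightarrow> 'a \<Rightarrow> bool" where
  "is_right_drazin_inverse c y \<longleftrightarrow>
     c * y * c = c^2 * y \<and> c * y^2 = y \<and> (\<exists>j::nat. c^(j + 1) * y = c^j)"

definition is_left_gen_drazin_inverse :: "'a::complex_banach_algebra_1 \<Rightarrow> 'a \<Rightarrow> bool" where
  "is_left_gen_drazin_inverse c x \<longleftrightarrow>
     c * x * c = x * c^2 \<and> x^2 * c = x \<and> c * x * c - c \<in> qnil"

definition is_right_gen_drazin_inverse :: "'a::complex_banach_algebra_1 \<Rightarrow> 'a \<Rightarrow> bool" where
  "is_right_gen_drazin_inverse c y \<longleftrightarrow>
     c * y * c = c^2 * y \<and> c * y^2 = y \<and> c * y * c - c \<in> qnil"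

end

theory Submission
  imports Defs
begin

text \<open>
  Put \<open>p = y * b\<close> in the left case and \<open>p = b * y\<close> in the right case, and \<open>q = a * x\<close>. Both are
  idempotents. Although \<open>b\<close> need not commute with its one-sided inverse \<open>y\<close>, it does commute with
  \<open>p\<close>: this is what \<open>b y b = y b\<^sup>2\<close>, respectively \<open>b y b = b\<^sup>2 y\<close>, says. Hence \<open>a\<close>, which lies in
  the double commutant of \<open>b\<close>, commutes with \<open>p\<close>. It need not commute with \<open>y\<close>.
  
  The two-sided inverse \<open>x\<close> lies in the double commutant of \<open>a\<close> (\<open>gen_drazin_inverse_in_comm2\<close>),
  hence in that of \<open>b\<close>, so \<open>x\<close> commutes with \<open>b\<close> and \<open>p\<close> as well. With these relations the algebraic
  identities for \<open>a b\<close> are a rewriting exercise in which \<open>y\<close> is only ever moved as a part of \<open>p\<close>;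
  the result is \<open>(a b) (y x) (a b) = a b p q\<close>, and likewise with \<open>x y\<close> on the right. In the Drazin
  case the index for \<open>a b\<close> is the larger of the two given indices.
  
  In the generalized case the defect splits as
  \<open>a b - a b p q = a \<cdot> b (1 - p) + b p \<cdot> a (1 - q)\<close>. The hypotheses say that \<open>b (1 - p)\<close> and \<open>a (1 - q)\<close>
  are quasi-nilpotent, each summand is a product of such an element with an element commuting with
  it, and the two summands annihilate each other because \<open>p (1 - p) = 0\<close>
  (\<open>qnil_mult_one_minus_projections\<close>).
  
  Everything analytic enters through \<open>qnil_iff_powers_decay\<close>: \<open>c\<close> is quasi-nilpotent iff
  \<open>(R c)\<^sup>n \<longlonglongrightarrow> 0\<close> for every real \<open>R\<close>. In this form, closure under products with commuting elements
  and under orthogonal sums is immediate, and so is the estimate behind the double commutant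
  property. That quasi-nilpotence implies decay is the substance of the spectral radius
  formula. It is proved by Rickart's averaging of the resolvent over roots of unity, which takes the
  place of Cauchy's integral formula: the averages of \<open>(1 - z c)\<^sup>-\<^sup>1\<close> over the \<open>n\<close>-th roots of unity
  times \<open>R\<close> are \<open>(1 - R\<^sup>n c\<^sup>n)\<^sup>-\<^sup>1\<close>, and they inherit from the resolvent a modulus of continuity in
  \<open>R\<close> that does not depend on \<open>n\<close>.
\<close>

section \<open>Complex scalars\<close>

lemma scaleC_one: "1 *\<^sub>C (x::'a::complex_banach_algebra_1) = x"
  using scaleC_of_real[of 1 x] by simp

lemma scaleC_zero_left: "0 *\<^sub>C (x::'a::complex_banach_algebra_1) = 0"
  using scaleC_of_real[of 0 x] by simp

lemma scaleC_diff_left: "(z - w) *\<^sub>C (x::'a::complex_banach_algebra_1) = z *\<^sub>C x - w *\<^sub>C x"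
  using scaleC_add_left[of "z - w" w x] by (simp add: algebra_simps)

lemma scaleC_diff_right: "z *\<^sub>C (x - y::'a::complex_banach_algebra_1) = z *\<^sub>C x - z *\<^sub>C y"
  using scaleC_add_right[of z "x - y" y] by (simp add: algebra_simps)

lemma scaleC_sum_left:
  "(\<Sum>k\<in>K. g k) *\<^sub>C (x::'a::complex_banach_algebra_1) = (\<Sum>k\<in>K. g k *\<^sub>C x)"
  by (induction K rule: infinite_finite_induct) (simp_all add: scaleC_zero_left scaleC_add_left)

lemma scaleC_power: "(z *\<^sub>C (x::'a::complex_banach_algebra_1)) ^ n = z ^ n *\<^sub>C x ^ n"
  by (induction n) (simp_all add: scaleC_one mult_scaleC_left mult_scaleC_right scaleC_scaleC mult.commute)

section \<open>Decay of powers\<close>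

text \<open>
  Asking for decay at every scale expresses \<open>\<parallel>c\<^sup>n\<parallel>\<^sup>1\<^sup>/\<^sup>n \<longlonglongrightarrow> 0\<close>, the vanishing of the spectral
  radius in Gelfand's formula, without roots and without complex scalars.
\<close>

definition powers_decay :: "'a::real_normed_algebra_1 \<Rightarrow> bool" where
  "powers_decay c \<longleftrightarrow> (\<forall>R::real. (\<lambda>n. (R *\<^sub>R c) ^ n) \<longlonglongrightarrow> 0)"

lemma powers_tendsto_0_if_bounded_at_larger_scale:
  fixes c :: "'a::real_normed_algebra_1"
  assumes "\<forall>\<^sub>F n in sequentially. norm ((R *\<^sub>R c) ^ n) \<le> B" and "0 \<le> S" "S < R"
  shows "(\<lambda>n. (S *\<^sub>R c) ^ n) \<longlonglongrightarrow> 0"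
proof (rule Lim_null_comparison)
  have R: "R > 0" using assms by simp
  show "(\<lambda>n. (S / R) ^ n * B) \<longlonglongrightarrow> 0"
    using assms R by (intro tendsto_mult_left_zero LIMSEQ_power_zero) simp
  show "\<forall>\<^sub>F n in sequentially. norm ((S *\<^sub>R c) ^ n) \<le> (S / R) ^ n * B"
    using assms(1)
  proof eventually_elim
    case (elim n)
    have "norm ((S *\<^sub>R c) ^ n) = (S / R) ^ n * norm ((R *\<^sub>R c) ^ n)"
      using R assms(2) by (simp add: power_divide)
    also have "\<dots> \<le> (S / R) ^ n * B"
      using elim R assms(2) by (intro mult_left_mono) auto
    finally show ?case .
  qed
qed

lemma powers_decay_if_nilpotent:
  fixes c :: "'a::real_normed_algebra_1"
  assumes "c ^ m = 0"
  shows "powers_decay c"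
  unfolding powers_decay_def
proof
  fix R :: real
  have "\<forall>\<^sub>F n in sequentially. (R *\<^sub>R c) ^ n = 0"
    using eventually_ge_at_top[of m]
  proof eventually_elim
    case (elim n)
    have "c ^ n = c ^ m * c ^ (n - m)" using elim by (simp flip: power_add)
    then show ?case using assms by simp
  qed
  then show "(\<lambda>n. (R *\<^sub>R c) ^ n) \<longlonglongrightarrow> 0" by (rule tendsto_eventually)
qed

lemma power_mult_distrib_commuting:
  fixes x y :: "'a::monoid_mult"
  assumes "x * y = y * x"
  shows "(x * y) ^ n = x ^ n * y ^ n"
proof (induction n)
  case (Suc n)
  have "y * x ^ n = x ^ n * y" using power_commuting_commutes[OF assms, of n] by simp
  then show ?case using Suc by (simp add: mult.assoc) (metis mult.assoc)
qed simp

lemma powers_decay_mult: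
  fixes c w :: "'a::real_normed_algebra_1"
  assumes "powers_decay c" "w * c = c * w"
  shows "powers_decay (w * c)"
  unfolding powers_decay_def
proof
  fix R :: real
  show "(\<lambda>n. (R *\<^sub>R (w * c)) ^ n) \<longlonglongrightarrow> 0"
  proof (rule Lim_null_comparison)
    show "(\<lambda>n. norm (((norm w * R) *\<^sub>R c) ^ n)) \<longlonglongrightarrow> 0"
      using assms(1) unfolding powers_decay_def by (intro tendsto_norm_zero) blast
    have "norm ((R *\<^sub>R (w * c)) ^ n) \<le> norm (((norm w * R) *\<^sub>R c) ^ n)" for n
    proof -
      have "norm ((R *\<^sub>R (w * c)) ^ n) = \<bar>R\<bar> ^ n * norm (w ^ n * c ^ n)"
        by (simp add: power_mult_distrib_commuting[OF assms(2)] power_abs)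
      also have "\<dots> \<le> \<bar>R\<bar> ^ n * (norm w ^ n * norm (c ^ n))"
        by (intro mult_left_mono order_trans[OF norm_mult_ineq] mult_right_mono norm_power_ineq) auto
      finally show ?thesis
        by (simp add: power_mult_distrib power_abs abs_mult mult_ac)
    qed
    then show "\<forall>\<^sub>F n in sequentially.
        norm ((R *\<^sub>R (w * c)) ^ n) \<le> norm (((norm w * R) *\<^sub>R c) ^ n)" by simp
  qed
qed

lemma powers_decay_uminus: "powers_decay c \<Longrightarrow> powers_decay (- c)"
  using powers_decay_mult[of c "- 1"] by simp

text \<open>
  Mutually annihilating summands have no mixed products, so \<open>(c + d)\<^sup>n = c\<^sup>n + d\<^sup>n\<close> for \<open>n > 0\<close>.
\<close>

lemma powers_decay_add_orthogonal:
  fixes c d :: "'a::real_normed_algebra_1"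
  assumes "powers_decay c" "powers_decay d" "c * d = 0" "d * c = 0"
  shows "powers_decay (c + d)"
  unfolding powers_decay_def
proof
  fix R :: real
  have pow: "(c + d) ^ Suc n = c ^ Suc n + d ^ Suc n" for n
  proof (induction n)
    case (Suc n)
    have "c * d ^ Suc n = 0" "d * c ^ Suc n = 0"
      using assms by (simp_all flip: mult.assoc)
    then show ?case
      unfolding power_Suc[of _ "Suc n"] Suc by (simp add: algebra_simps)
  qed simp
  have "(\<lambda>n. (R *\<^sub>R c) ^ Suc n + (R *\<^sub>R d) ^ Suc n) \<longlonglongrightarrow> 0 + 0"
    using assms unfolding powers_decay_def by (intro tendsto_add LIMSEQ_Suc) blast+
  then have "(\<lambda>n. (R *\<^sub>R (c + d)) ^ Suc n) \<longlonglongrightarrow> 0"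
    unfolding scaleR_power pow by (simp add: scaleR_add_right del: power_Suc)
  then show "(\<lambda>n. (R *\<^sub>R (c + d)) ^ n) \<longlonglongrightarrow> 0" by (rule LIMSEQ_imp_Suc)
qed

section \<open>Quasi-nilpotent elements are those whose powers decay\<close>

lemma geometric_series_inverse:
  fixes t :: "'a::{real_normed_algebra_1,banach}"
  assumes "summable (\<lambda>n. t ^ n)"
  shows "(1 - t) * (\<Sum>n. t ^ n) = 1" "(\<Sum>n. t ^ n) * (1 - t) = 1"
proof -
  have tail: "(\<Sum>n. t ^ Suc n) = (\<Sum>n. t ^ n) - 1"
    using suminf_split_head[OF assms] by simp
  have "t * (\<Sum>n. t ^ n) = (\<Sum>n. t ^ n) - 1"
    using suminf_mult[OF assms, of t] tail by simp
  then show "(1 - t) * (\<Sum>n. t ^ n) = 1" by (simp add: algebra_simps)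
  have "(\<Sum>n. t ^ n) * t = (\<Sum>n. t ^ n) - 1"
    using suminf_mult2[OF assms, of t] tail by (simp add: power_commutes)
  then show "(\<Sum>n. t ^ n) * (1 - t) = 1" by (simp add: algebra_simps)
qed

lemma notin_spectrum_if_geometric_summable:
  fixes c :: "'a::complex_banach_algebra_1"
  assumes "z \<noteq> 0" "summable (\<lambda>n. (inverse z *\<^sub>C c) ^ n)"
  shows "z \<notin> spectrum c"
proof -
  define u where "u = (\<Sum>n. (inverse z *\<^sub>C c) ^ n)"
  have "z *\<^sub>C 1 - c = z *\<^sub>C (1 - inverse z *\<^sub>C c)"
    using assms(1) by (simp add: scaleC_diff_right scaleC_scaleC scaleC_one)
  then have "(z *\<^sub>C 1 - c) * (inverse z *\<^sub>C u) = 1" "(inverse z *\<^sub>C u) * (z *\<^sub>C 1 - c) = 1"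
    using geometric_series_inverse[OF assms(2)] assms(1) unfolding u_def
    by (simp_all add: mult_scaleC_left mult_scaleC_right scaleC_scaleC scaleC_one)
  then show ?thesis unfolding spectrum_def by blast
qed

lemma spectrum_bounded_by_norm:
  fixes c :: "'a::complex_banach_algebra_1"
  assumes "z \<in> spectrum c"
  shows "cmod z \<le> norm c"
proof (rule ccontr)
  assume less: "\<not> cmod z \<le> norm c"
  then have "z \<noteq> 0" by auto
  with less have "norm (inverse z *\<^sub>C c) < 1"
    using mult_strict_left_mono[of "norm c" "cmod z" "inverse (cmod z)"]
    by (simp add: norm_scaleC norm_inverse)
  then show False
    using notin_spectrum_if_geometric_summable[OF \<open>z \<noteq> 0\<close> complete_algebra_summable_geometric]
      assms by blast
qed

text \<open>
  Decay at scale \<open>2 / \<bar>z\<bar>\<close> makes the Neumann series for \<open>(1 - z\<^sup>-\<^sup>1 c)\<^sup>-\<^sup>1\<close> converge, so the spectrum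
  is contained in \<open>{0}\<close>. An inverse \<open>u\<close> of \<open>c\<close> would give \<open>1 = u c\<close>, a product of commuting
  factors, decaying powers. So the spectrum equals \<open>{0}\<close> and the supremum defining the spectral
  radius is over a nonempty set.
\<close>

lemma qnil_if_powers_decay:
  fixes c :: "'a::complex_banach_algebra_1"
  assumes "powers_decay c"
  shows "c \<in> qnil"
proof -
  have "z \<notin> spectrum c" if "z \<noteq> 0" for z
  proof (rule notin_spectrum_if_geometric_summable[OF that])
    define r where "r = cmod (inverse z)"
    have "Bseq (\<lambda>n. ((2 * r) *\<^sub>R c) ^ n)"
      using assms convergent_imp_Bseq convergentI unfolding powers_decay_def by blast
    then obtain B where B: "\<And>n. norm (((2 * r) *\<^sub>R c) ^ n) \<le> B"
      unfolding Bseq_def by blast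
    have "norm ((inverse z *\<^sub>C c) ^ n) \<le> (1 / 2) ^ n * B" for n
    proof -
      have "norm ((inverse z *\<^sub>C c) ^ n) = (1 / 2) ^ n * norm (((2 * r) *\<^sub>R c) ^ n)"
        unfolding r_def
        by (simp add: scaleC_power norm_scaleC norm_power power_mult_distrib power_divide
            abs_mult power_abs)
      then show ?thesis using B[of n] by simp
    qed
    then show "summable (\<lambda>n. (inverse z *\<^sub>C c) ^ n)"
      by (intro summable_comparison_test[OF _ summable_mult2[OF summable_geometric[of "1/2::real"]]]) auto
  qed
  moreover have "0 \<in> spectrum c"
  proof (rule ccontr)
    assume "0 \<notin> spectrum c"
    then obtain u where u: "- c * u = 1" "u * - c = 1"
      unfolding spectrum_def by (auto simp: scaleC_zero_left)
    then have "powers_decay (u * - c)"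
      by (intro powers_decay_mult powers_decay_uminus assms) simp
    then have "(\<lambda>n. (1 *\<^sub>R (1::'a)) ^ n) \<longlonglongrightarrow> 0"
      using u unfolding powers_decay_def by metis
    then have "(\<lambda>n::nat. 1::'a) \<longlonglongrightarrow> 0" by simp
    then show False by (simp add: LIMSEQ_const_iff)
  qed
  ultimately have "spectrum c = {0}" by blast
  then show ?thesis unfolding qnil_def spectral_radius_def by simp
qed

lemma one_minus_scaleC_invertible_if_qnil:
  fixes c :: "'a::complex_banach_algebra_1"
  assumes "c \<in> qnil"
  shows "\<exists>u. (1 - z *\<^sub>C c) * u = 1 \<and> u * (1 - z *\<^sub>C c) = 1"
proof (cases "z = 0")
  case False
  have "inverse z \<notin> spectrum c"
  proof
    assume z: "inverse z \<in> spectrum c"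
    have "cmod (inverse z) \<le> spectral_radius c"
      unfolding spectral_radius_def
      by (rule cSUP_upper[OF z]) (auto intro: spectrum_bounded_by_norm)
    then show False using assms False by (simp add: qnil_def)
  qed
  then obtain u where u: "(inverse z *\<^sub>C 1 - c) * u = 1" "u * (inverse z *\<^sub>C 1 - c) = 1"
    unfolding spectrum_def by blast
  have "1 - z *\<^sub>C c = z *\<^sub>C (inverse z *\<^sub>C 1 - c)"
    using False by (simp add: scaleC_diff_right scaleC_scaleC scaleC_one)
  then have "(1 - z *\<^sub>C c) * (inverse z *\<^sub>C u) = 1 \<and> (inverse z *\<^sub>C u) * (1 - z *\<^sub>C c) = 1"
    using u False
    by (simp add: mult_scaleC_left mult_scaleC_right scaleC_scaleC scaleC_one)
  then show ?thesis by blast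
qed (simp add: scaleC_zero_left)

text \<open>
  The resolvent identity \<open>f z - f w = (z - w) f z c f w\<close> first bounds \<open>f z\<close> by \<open>2 \<parallel>f w\<parallel>\<close> near \<open>w\<close>, and
  then shows that \<open>f\<close> is continuous at \<open>w\<close>.
\<close>

lemma continuous_resolvent:
  fixes c :: "'a::complex_banach_algebra_1"
  assumes f: "\<And>z. (1 - z *\<^sub>C c) * f z = 1" "\<And>z. f z * (1 - z *\<^sub>C c) = 1"
  shows "continuous_on UNIV f"
proof (rule continuous_at_imp_continuous_on, rule ballI)
  fix w
  have resolvent_eq: "f z - f w = (z - w) *\<^sub>C (f z * c * f w)" for z
  proof -
    have "f z - f w = f z * ((1 - w *\<^sub>C c) * f w) - (f z * (1 - z *\<^sub>C c)) * f w"
      by (simp only: f mult_1_left mult_1_right)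
    also have "\<dots> = f z * ((z - w) *\<^sub>C c) * f w"
      by (simp add: scaleC_diff_left algebra_simps)
    finally show ?thesis by (simp add: mult_scaleC_left mult_scaleC_right)
  qed
  define L where "L = norm c * norm (f w)"
  have L: "L \<ge> 0" unfolding L_def by simp
  have bd: "norm (f z - f w) \<le> cmod (z - w) * (norm (f z) * L)" for z
  proof -
    have "norm (f z * c * f w) \<le> norm (f z) * norm (c * f w)"
      unfolding mult.assoc by (rule norm_mult_ineq)
    also have "\<dots> \<le> norm (f z) * L"
      unfolding L_def by (intro mult_left_mono norm_mult_ineq norm_ge_zero)
    finally show ?thesis
      unfolding resolvent_eq norm_scaleC by (intro mult_left_mono) auto
  qed
  have lim: "(\<lambda>z. cmod (z - w) * L) \<midarrow>w\<rightarrow> 0"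
    by (intro tendsto_mult_left_zero tendsto_norm_zero LIM_zero tendsto_ident_at)
  have "\<forall>\<^sub>F z in at w. cmod (z - w) * L < 1 / 2"
    using order_tendstoD(2)[OF lim, of "1/2"] by simp
  then have ev: "\<forall>\<^sub>F z in at w. norm (f z - f w) \<le> cmod (z - w) * L * (2 * norm (f w))"
  proof eventually_elim
    case (elim z)
    have "norm (f z) \<le> norm (f w) + norm (f z - f w)"
      using norm_triangle_ineq[of "f w" "f z - f w"] by simp
    also have "\<dots> \<le> norm (f w) + (cmod (z - w) * L) * norm (f z)"
      using bd[of z] by (simp add: mult_ac)
    also have "\<dots> \<le> norm (f w) + 1 / 2 * norm (f z)"
      using elim by (intro add_left_mono mult_right_mono) auto
    finally have "norm (f z) \<le> 2 * norm (f w)" by simp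
    then have "(cmod (z - w) * L) * norm (f z) \<le> (cmod (z - w) * L) * (2 * norm (f w))"
      using L by (intro mult_left_mono) auto
    then show ?case using bd[of z] by (simp add: mult_ac)
  qed
  have "(\<lambda>z. f z - f w) \<midarrow>w\<rightarrow> 0"
    by (rule Lim_null_comparison[OF ev]) (intro tendsto_mult_left_zero lim)
  then show "isCont f w" unfolding isCont_def by (rule LIM_zero_cancel)
qed

lemma sum_powers_root_of_unity:
  assumes "0 < i" "i < n"
  shows "(\<Sum>k<n. (cis (2 * pi * real k / real n)) ^ i) = 0"
proof -
  define \<omega> where "\<omega> = cis (2 * pi * real i / real n)"
  have "cis (2 * pi * real k / real n) ^ i = \<omega> ^ k" for k
    unfolding \<omega>_def by (simp add: Complex.DeMoivre mult_ac)
  then have "(\<Sum>k<n. cis (2 * pi * real k / real n) ^ i) = (\<Sum>k<n. \<omega> ^ k)" by simp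
  also have "\<dots> = 0"
  proof -
    have "\<omega> ^ n = 1"
      unfolding \<omega>_def using assms by (simp add: Complex.DeMoivre)
    moreover have "\<omega> \<noteq> 1"
    proof
      assume "\<omega> = 1"
      then have "cos (2 * pi * real i / real n) = 1"
        unfolding \<omega>_def by (simp add: complex_eq_iff)
      then obtain m :: int where "2 * pi * real i / real n = of_int m * 2 * pi"
        using cos_one_2pi_int by blast
      then have "real i = of_int m * real n"
        using assms by (simp add: field_simps)
      then have "int i = m * int n"
        by (metis of_int_eq_iff of_int_mult of_int_of_nat_eq)
      then have "int n dvd int i" by simp
      then show False using assms by (simp add: nat_dvd_not_less)
    qed
    ultimately show ?thesis by (simp add: geometric_sum)
  qed
  finally show ?thesis .
qed

text \<open>
  If \<open>\<zeta>\<^sup>n = 1\<close>, then \<open>t = \<zeta> R c\<close> satisfies \<open>t\<^sup>n = (R c)\<^sup>n\<close>, and \<open>(1 - t)\<^sup>-\<^sup>1 (1 - t\<^sup>n)\<close> is the finite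
  geometric sum of the \<open>t\<^sup>i\<close>. Averaging over \<open>\<zeta>\<close> removes every term but \<open>i = 0\<close>.
\<close>

lemma average_resolvent_over_roots_of_unity:
  fixes c :: "'a::complex_banach_algebra_1" and R :: real
  assumes f: "\<And>z. f z * (1 - z *\<^sub>C c) = 1"
    and n: "n > 0"
  defines "p \<equiv> (1 / real n) *\<^sub>R (\<Sum>k<n. f (complex_of_real R * cis (2 * pi * real k / real n)))"
  shows "p * (1 - (R *\<^sub>R c) ^ n) = 1"
proof -
  define \<zeta> where "\<zeta> k = cis (2 * pi * real k / real n)" for k
  have term_eq: "f (complex_of_real R * \<zeta> k) * (1 - (R *\<^sub>R c) ^ n) = (\<Sum>i<n. \<zeta> k ^ i *\<^sub>C (R *\<^sub>R c) ^ i)" for k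
  proof -
    define t where "t = (complex_of_real R * \<zeta> k) *\<^sub>C c"
    have t: "t = \<zeta> k *\<^sub>C (R *\<^sub>R c)"
      unfolding t_def by (simp add: scaleC_scaleC mult.commute flip: scaleC_of_real)
    have "\<zeta> k ^ n = 1"
      unfolding \<zeta>_def using n by (simp add: Complex.DeMoivre)
    then have "(R *\<^sub>R c) ^ n = t ^ n"
      unfolding t by (simp add: scaleC_power scaleC_one)
    moreover have "(1 - t) * (\<Sum>i<n. t ^ i) = 1 - t ^ n"
      by (induction n) (simp_all add: distrib_left, simp add: left_diff_distrib)
    ultimately have "f (complex_of_real R * \<zeta> k) * (1 - (R *\<^sub>R c) ^ n)
        = (f (complex_of_real R * \<zeta> k) * (1 - t)) * (\<Sum>i<n. t ^ i)"
      by (simp add: mult.assoc)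
    also have "\<dots> = (\<Sum>i<n. t ^ i)" unfolding t_def f by simp
    finally show ?thesis unfolding t by (simp add: scaleC_power)
  qed
  have "(\<Sum>k<n. f (complex_of_real R * \<zeta> k)) * (1 - (R *\<^sub>R c) ^ n)
      = (\<Sum>k<n. \<Sum>i<n. \<zeta> k ^ i *\<^sub>C (R *\<^sub>R c) ^ i)"
    by (simp only: sum_distrib_right term_eq)
  also have "\<dots> = (\<Sum>i<n. (\<Sum>k<n. \<zeta> k ^ i) *\<^sub>C (R *\<^sub>R c) ^ i)"
    by (subst sum.swap) (simp add: scaleC_sum_left)
  also have "\<dots> = (\<Sum>i<n. if i = 0 then of_nat n *\<^sub>C 1 else 0)"
    by (intro sum.cong refl) (auto simp: \<zeta>_def sum_powers_root_of_unity scaleC_zero_left)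
  also have "\<dots> = real n *\<^sub>R 1"
    using n scaleC_of_real[of "real n" "1::'a"] by simp
  finally show ?thesis
    using n unfolding p_def \<zeta>_def by simp
qed

lemma norm_le_if_left_inverse_near_1:
  fixes p u :: "'a::real_normed_algebra_1"
  assumes "p * u = 1" "norm (p - 1) \<le> 1 / 2"
  shows "norm u \<le> 2"
proof -
  have "u = 1 - (p - 1) * u" using assms(1) by (simp add: algebra_simps)
  then have "norm u \<le> 1 + norm ((p - 1) * u)"
    by (metis norm_one norm_triangle_ineq4)
  also have "norm ((p - 1) * u) \<le> 1 / 2 * norm u"
    by (intro order_trans[OF norm_mult_ineq] mult_right_mono assms) simp
  finally show ?thesis by simp
qed

text \<open>
  Let \<open>p n R = (1 - (R c)\<^sup>n)\<^sup>-\<^sup>1\<close>. As an average of resolvent values at modulus \<open>R\<close>, it is uniformly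
  continuous in \<open>R\<close> on bounded intervals, with a modulus \<open>d\<close> independent of \<open>n\<close>. If \<open>(R c)\<^sup>n \<longlonglongrightarrow> 0\<close>,
  then \<open>p n R \<longlonglongrightarrow> 1\<close>, so \<open>p n S\<close> stays within \<open>1/2\<close> of \<open>1\<close> for \<open>\<bar>S - R\<bar> < d\<close> and large \<open>n\<close>, which
  bounds \<open>(S c)\<^sup>n\<close>. Boundedness at \<open>S\<close> gives decay at every smaller scale, so finitely many steps of
  fixed length \<open>h\<close>, starting from \<open>R = 0\<close>, reach any given scale.
\<close>

lemma powers_decay_if_qnil:
  fixes c :: "'a::complex_banach_algebra_1"
  assumes "c \<in> qnil"
  shows "powers_decay c"
proof -
  obtain f where f: "\<And>z. (1 - z *\<^sub>C c) * f z = 1" "\<And>z. f z * (1 - z *\<^sub>C c) = 1"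
    using one_minus_scaleC_invertible_if_qnil[OF assms] by metis
  define p where
    "p n R = (1 / real n) *\<^sub>R (\<Sum>k<n. f (complex_of_real R * cis (2 * pi * real k / real n)))" for n R
  have p: "p n R * (1 - (R *\<^sub>R c) ^ n) = 1" if "n > 0" for n R
    unfolding p_def by (rule average_resolvent_over_roots_of_unity[OF f(2) that])
  have decay: "(\<lambda>n. (K *\<^sub>R c) ^ n) \<longlonglongrightarrow> 0" if K: "K > 0" for K
  proof -
    \<comment> \<open>The radius \<open>2 * K\<close> leaves room for the steps below, which look one step beyond \<open>K\<close>.\<close>
    have "uniformly_continuous_on (cball 0 (2 * K)) f"
      by (rule compact_uniformly_continuous[OF continuous_on_subset[OF continuous_resolvent[OF f]]]) auto
    then have "\<exists>d>0. \<forall>z\<in>cball 0 (2 * K). \<forall>w\<in>cball 0 (2 * K). dist w z < d \<longrightarrow> dist (f w) (f z) < 1 / 4"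
      unfolding uniformly_continuous_on_def by (rule allE[of _ "1 / 4"]) simp
    then obtain d where d: "d > 0"
      "\<And>z w. z \<in> cball 0 (2 * K) \<Longrightarrow> w \<in> cball 0 (2 * K) \<Longrightarrow> dist w z < d \<Longrightarrow> dist (f w) (f z) < 1 / 4"
      by blast
    have p_close: "norm (p n R - p n S) \<le> 1 / 4"
      if n: "n > 0" and RS: "0 \<le> R" "R \<le> 2 * K" "0 \<le> S" "S \<le> 2 * K" "\<bar>R - S\<bar> < d" for n R S
    proof -
      define \<zeta> where "\<zeta> k = cis (2 * pi * real k / real n)" for k
      have "norm (f (complex_of_real R * \<zeta> k) - f (complex_of_real S * \<zeta> k)) \<le> 1 / 4" for k
      proof -
        have "dist (complex_of_real R * \<zeta> k) (complex_of_real S * \<zeta> k) = \<bar>R - S\<bar>"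
          unfolding dist_norm \<zeta>_def left_diff_distrib[symmetric] of_real_diff[symmetric]
          by (simp only: norm_mult norm_of_real norm_cis) simp
        then show ?thesis
          using d(2)[of "complex_of_real S * \<zeta> k" "complex_of_real R * \<zeta> k"] RS
          by (simp add: norm_mult \<zeta>_def dist_norm)
      qed
      then have "norm (\<Sum>k<n. f (complex_of_real R * \<zeta> k) - f (complex_of_real S * \<zeta> k)) \<le> real n * (1 / 4)"
        using sum_norm_bound[of "{..<n}" "\<lambda>k. f (complex_of_real R * \<zeta> k) - f (complex_of_real S * \<zeta> k)" "1 / 4"]
        by simp
      moreover have "p n R - p n S
          = (1 / real n) *\<^sub>R (\<Sum>k<n. f (complex_of_real R * \<zeta> k) - f (complex_of_real S * \<zeta> k))"
        unfolding p_def \<zeta>_def by (simp add: sum_subtractf scaleR_diff_right)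
      ultimately show ?thesis using n by (simp add: field_simps)
    qed
    have bounded_step: "\<forall>\<^sub>F n in sequentially. norm ((S *\<^sub>R c) ^ n) \<le> 3"
      if lim: "(\<lambda>n. (R *\<^sub>R c) ^ n) \<longlonglongrightarrow> 0"
        and RS: "0 \<le> R" "R \<le> 2 * K" "0 \<le> S" "S \<le> 2 * K" "\<bar>S - R\<bar> < d" for R S
    proof -
      have "\<forall>\<^sub>F n in sequentially. norm ((R *\<^sub>R c) ^ n) < 1 / 8"
        using tendstoD[OF lim, of "1/8"] by simp
      then show ?thesis
        using eventually_gt_at_top[of 0]
      proof eventually_elim
        case (elim n)
        define t where "t = (R *\<^sub>R c) ^ n"
        have pt: "p n R - 1 = p n R * t"
          using p[OF elim(2), of R] unfolding t_def by (simp add: algebra_simps)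
        have "norm (p n R - 1) \<le> norm (p n R) * (1 / 8)"
          unfolding pt using elim(1) t_def
          by (intro order_trans[OF norm_mult_ineq] mult_left_mono) auto
        moreover have "norm (p n R) \<le> 1 + norm (p n R - 1)"
          using norm_triangle_ineq[of 1 "p n R - 1"] by simp
        ultimately have "norm (p n R - 1) \<le> 1 / 4" by simp
        moreover have "norm (p n S - 1) \<le> norm (p n S - p n R) + norm (p n R - 1)"
          using norm_triangle_ineq[of "p n S - p n R" "p n R - 1"] by simp
        ultimately have "norm (p n S - 1) \<le> 1 / 2"
          using p_close[OF elim(2), of S R] RS by linarith
        then have "norm (1 - (S *\<^sub>R c) ^ n) \<le> 2"
          by (rule norm_le_if_left_inverse_near_1[OF p[OF elim(2)]])
        then show ?case
          using norm_triangle_ineq4[of 1 "1 - (S *\<^sub>R c) ^ n"] by simp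
      qed
    qed
    obtain N :: nat where N: "2 * K / d < real N"
      using reals_Archimedean2 by blast
    moreover have "0 < 2 * K / d" using d(1) K by simp
    ultimately have "N > 0" by (intro gr0I) auto
    \<comment> \<open>Each step first overshoots by \<open>2 * h\<close>, where only boundedness is known, and then retreats by \<open>h\<close>.\<close>
    define h where "h = K / real N"
    have h: "h > 0" "2 * h < d" "real N * h = K"
      using N \<open>N > 0\<close> K d(1) unfolding h_def by (simp_all add: field_simps)
    have "(\<lambda>n. ((real i * h) *\<^sub>R c) ^ n) \<longlonglongrightarrow> 0" if "i \<le> N" for i
      using that
    proof (induction i)
      case 0
      have "(\<lambda>n. (0::'a) ^ n) \<longlonglongrightarrow> 0"
        by (rule LIMSEQ_imp_Suc) simp
      then show ?case by simp
    next
      case (Suc i)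
      have le: "real (i + 2) * h \<le> 2 * K"
      proof -
        have "real (i + 2) \<le> 2 * real N" using Suc.prems by simp
        then have "real (i + 2) * h \<le> 2 * real N * h" using h(1) by (intro mult_right_mono) auto
        then show ?thesis using h(3) by simp
      qed
      have "real i * h \<le> real (i + 2) * h" using h(1) by (intro mult_right_mono) auto
      with le have le': "real i * h \<le> 2 * K" by simp
      have diff: "\<bar>real (i + 2) * h - real i * h\<bar> < d"
        using h by (simp add: algebra_simps)
      show ?case
      proof (rule powers_tendsto_0_if_bounded_at_larger_scale)
        show "\<forall>\<^sub>F n in sequentially. norm (((real (i + 2) * h) *\<^sub>R c) ^ n) \<le> 3"
          by (rule bounded_step[OF Suc.IH]) (use Suc.prems h(1) le le' diff in auto)
        show "real (Suc i) * h < real (i + 2) * h" using h(1) by simp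
      qed (use h(1) in simp)
    qed
    from this[of N] show ?thesis using h(3) by simp
  qed
  show ?thesis
    unfolding powers_decay_def
  proof
    fix R :: real
    have lim: "(\<lambda>n. norm (((\<bar>R\<bar> + 1) *\<^sub>R c) ^ n)) \<longlonglongrightarrow> 0"
      by (intro tendsto_norm_zero decay) simp
    have bound: "norm ((R *\<^sub>R c) ^ n) \<le> norm (((\<bar>R\<bar> + 1) *\<^sub>R c) ^ n)" for n
    proof -
      have "\<bar>R ^ n\<bar> \<le> (\<bar>R\<bar> + 1) ^ n" unfolding power_abs by (intro power_mono) auto
      then show ?thesis by (auto intro: mult_right_mono)
    qed
    show "(\<lambda>n. (R *\<^sub>R c) ^ n) \<longlonglongrightarrow> 0"
      by (rule Lim_null_comparison[OF always_eventually lim]) (simp only: bound simp_thms)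
  qed
qed

theorem qnil_iff_powers_decay: "c \<in> qnil \<longleftrightarrow> powers_decay c"
  using qnil_if_powers_decay powers_decay_if_qnil by blast

section \<open>The generalized Drazin inverse lies in the double commutant\<close>

text \<open>
  With the idempotent \<open>e = 1 - a x\<close>, \<open>(a e)\<^bsup>j+1\<^esup> = a (a\<^sup>j - a\<^bsup>j+1\<^esup> x) = 0\<close>, so the defect \<open>a e\<close> is
  nilpotent.
\<close>

lemma gen_drazin_inverse_if_drazin_inverse:
  assumes "is_drazin_inverse a x"
  shows "is_gen_drazin_inverse a x"
proof -
  from assms obtain j where ax: "a * x = x * a" "x^2 * a = x" and j: "a ^ (j + 1) * x = a ^ j"
    unfolding is_drazin_inverse_def by blast
  define e where "e = 1 - a * x"
  have e: "e * e = e" and ae: "a * e = e * a"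
    using ax unfolding e_def power2_eq_square by (simp_all add: algebra_simps) (metis mult.assoc)+
  have "(a * e) ^ Suc j = a ^ Suc j * e ^ Suc j"
    by (rule power_mult_distrib_commuting[OF ae])
  also have "e ^ Suc j = e" by (induction j) (simp_all add: e)
  also have "a ^ Suc j * e = a * (a ^ j - a ^ (j + 1) * x)"
    unfolding e_def by (simp add: algebra_simps) (metis power_commutes mult.assoc)
  finally have "(a * e) ^ Suc j = 0" using j by simp
  then have "powers_decay (a * e)" by (rule powers_decay_if_nilpotent)
  moreover have "a - a * x * a = a * e"
    unfolding ae by (simp add: e_def left_diff_distrib)
  ultimately show ?thesis
    using ax by (simp add: is_gen_drazin_inverse_def qnil_iff_powers_decay)
qed

lemma drazin_projection:
  assumes "is_gen_drazin_inverse a x"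
  shows "(a * x) * (a * x) = a * x" "a * (a * x) = (a * x) * a" "x * (a * x) = x" "(a * x) * x = x"
    "powers_decay (a * (1 - a * x))"
proof -
  have ax: "a * x = x * a" "x * x * a = x" "a - a * x * a \<in> qnil"
    using assms unfolding is_gen_drazin_inverse_def power2_eq_square by auto
  show 1: "x * (a * x) = x" "(a * x) * x = x" using ax by (metis mult.assoc)+
  then show "(a * x) * (a * x) = a * x" by (simp add: mult.assoc)
  show "a * (a * x) = (a * x) * a" unfolding mult.assoc ax(1)[symmetric] ..
  then have "a * (1 - a * x) = a - a * x * a" by (simp add: algebra_simps)
  then show "powers_decay (a * (1 - a * x))" using ax(3) qnil_iff_powers_decay by metis
qed

lemma eq_0_if_norm_le_null_sequence:
  fixes v :: "'a::real_normed_vector"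
  assumes "\<And>n::nat. norm v \<le> B * norm (g n)" "g \<longlonglongrightarrow> (0::'b::real_normed_vector)"
  shows "v = 0"
proof -
  have "(\<lambda>n. B * norm (g n)) \<longlonglongrightarrow> 0"
    by (intro tendsto_mult_right_zero tendsto_norm_zero assms(2))
  then have "norm v \<le> 0" using assms(1) by (intro LIMSEQ_le_const) auto
  then show ?thesis by simp
qed

text \<open>
  Let \<open>w\<close> commute with \<open>a\<close>, and let \<open>q = a x\<close> and \<open>e = 1 - q\<close>. Since \<open>q = x\<^sup>n a\<^sup>n\<close> for all \<open>n > 0\<close>, the
  corner \<open>q w e\<close> equals \<open>x\<^sup>n w (a e)\<^sup>n\<close>, which tends to \<open>0\<close> because \<open>a e\<close> is quasi-nilpotent; being
  constant, it is \<open>0\<close>. The same holds for \<open>e w q\<close>, so \<open>w\<close> commutes with \<open>q\<close>. Then \<open>x = q x = x q\<close>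
  gives \<open>w x = q w x = x w a x = x w q = x q w = x w\<close>.
\<close>

lemma gen_drazin_inverse_in_comm2:
  assumes "is_gen_drazin_inverse a x"
  shows "x \<in> comm2 a"
  unfolding comm2_def
proof (clarify)
  fix w assume "w \<in> comm a"
  then have wa: "w * a = a * w" unfolding comm_def by simp
  have ax: "a * x = x * a" using assms unfolding is_gen_drazin_inverse_def by simp
  define q where "q = a * x"
  note P = drazin_projection[OF assms, folded q_def]
  define e where "e = 1 - q"
  have e: "e * e = e" "a * e = e * a" "powers_decay (a * e)"
    using P by (simp_all add: e_def algebra_simps)
  have wn: "w * a ^ n = a ^ n * w" for n
    using power_commuting_commutes[OF wa[symmetric], of n] by simp
  have qn: "q = x ^ Suc n * a ^ Suc n" "q = a ^ Suc n * x ^ Suc n" for n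
  proof -
    have "q ^ Suc n = q" by (induction n) (simp_all add: P)
    then show "q = x ^ Suc n * a ^ Suc n" "q = a ^ Suc n * x ^ Suc n"
      using power_mult_distrib_commuting[OF ax, of "Suc n"]
        power_mult_distrib_commuting[OF ax[symmetric], of "Suc n"] ax unfolding q_def by metis+
  qed
  have en: "a ^ Suc n * e = (a * e) ^ Suc n" "e * a ^ Suc n = (a * e) ^ Suc n" for n
  proof -
    have "e ^ Suc n = e" by (induction n) (simp_all add: e)
    then show "a ^ Suc n * e = (a * e) ^ Suc n" "e * a ^ Suc n = (a * e) ^ Suc n"
      using power_mult_distrib_commuting[OF e(2), of "Suc n"]
        power_mult_distrib_commuting[OF e(2)[symmetric], of "Suc n"] e(2) by metis+
  qed
  have lim: "(\<lambda>n. (norm x *\<^sub>R (a * e)) ^ Suc n) \<longlonglongrightarrow> 0"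
    using e(3) unfolding powers_decay_def by (intro LIMSEQ_Suc) blast
  have scale: "norm ((norm x *\<^sub>R (a * e)) ^ Suc n) = norm x ^ Suc n * norm ((a * e) ^ Suc n)" for n
    by (simp del: power_Suc)
  have qwe: "q * w * e = 0"
  proof (rule eq_0_if_norm_le_null_sequence[OF _ lim])
    fix n
    have "q * w * e = x ^ Suc n * (w * (a * e) ^ Suc n)"
      by (metis qn(1)[of n] wn en(1) mult.assoc)
    then have "norm (q * w * e) \<le> norm (x ^ Suc n) * (norm w * norm ((a * e) ^ Suc n))"
      by (simp only:) (intro order_trans[OF norm_mult_ineq] mult_left_mono norm_mult_ineq norm_ge_zero)
    also have "\<dots> \<le> norm x ^ Suc n * (norm w * norm ((a * e) ^ Suc n))"
      by (intro mult_right_mono norm_power_ineq mult_nonneg_nonneg norm_ge_zero)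
    finally show "norm (q * w * e) \<le> norm w * norm ((norm x *\<^sub>R (a * e)) ^ Suc n)"
      unfolding scale by (simp only: mult_ac)
  qed
  have ewq: "e * w * q = 0"
  proof (rule eq_0_if_norm_le_null_sequence[OF _ lim])
    fix n
    have "e * w * q = (e * a ^ Suc n) * (w * x ^ Suc n)"
      by (metis qn(2)[of n] wn mult.assoc)
    then have "norm (e * w * q) \<le> norm ((a * e) ^ Suc n) * (norm w * norm (x ^ Suc n))"
      unfolding en
      by (simp only:) (intro order_trans[OF norm_mult_ineq] mult_left_mono norm_mult_ineq norm_ge_zero)
    also have "\<dots> \<le> norm ((a * e) ^ Suc n) * (norm w * norm x ^ Suc n)"
      by (intro mult_left_mono norm_power_ineq norm_ge_zero)
    finally show "norm (e * w * q) \<le> norm w * norm ((norm x *\<^sub>R (a * e)) ^ Suc n)"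
      unfolding scale by (simp only: mult_ac)
  qed
  have "q * w = q * w * q" using qwe by (simp add: e_def right_diff_distrib)
  also have "\<dots> = w * q" using ewq by (simp add: e_def left_diff_distrib)
  finally have qw: "q * w = w * q" .
  then have "w * (q * x) = (q * w) * x" by (simp only: mult.assoc)
  also have "q * w = x * (w * a)" unfolding q_def ax wa by (simp only: mult.assoc)
  also have "x * (w * a) * x = x * (w * q)" unfolding q_def by (simp only: mult.assoc)
  also have "\<dots> = (x * q) * w" unfolding qw[symmetric] by (simp only: mult.assoc)
  finally show "x * w = w * x" unfolding P(3,4) by simp
qed

lemma comm2_trans:
  assumes "a \<in> comm2 b" "x \<in> comm2 a"
  shows "x \<in> comm2 b"
  using assms unfolding comm2_def comm_def by auto

section \<open>The reverse order law\<close>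

lemma commute_mult:
  fixes x y z :: "'a::semigroup_mult"
  assumes "x * z = z * x" "y * z = z * y"
  shows "x * y * z = z * (x * y)"
  using assms by (metis mult.assoc)

lemma commute_imp_left_commute:
  fixes x y z :: "'a::semigroup_mult"
  assumes "x * y = y * x"
  shows "x * (y * z) = y * (x * z)"
  using assms by (simp flip: mult.assoc)

lemma commute_one_minus:
  fixes x z :: "'a::ring_1"
  assumes "x * z = z * x"
  shows "(1 - x) * z = z * (1 - x)"
  using assms by (simp add: algebra_simps)

text \<open>
  \<open>a b - a b p q = a b (1 - p) + a b p (1 - q)\<close>, and the two summands annihilate each other because all
  the factors commute with \<open>p\<close>. So only products with commuting factors and orthogonal sums occur.
\<close>

lemma qnil_mult_one_minus_projections:
  fixes a b p q :: "'a::complex_banach_algebra_1"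
  assumes decay: "powers_decay (a * (1 - q))" "powers_decay (b * (1 - p))"
    and p: "p * p = p" and ab: "a * b = b * a" and ap: "a * p = p * a" and bp: "b * p = p * b"
    and qb: "q * b = b * q" and qp: "q * p = p * q" and qa: "q * a = a * q"
  shows "a * b * (p * q) - a * b \<in> qnil"
proof -
  define e where "e = 1 - p"
  define f where "f = 1 - q"
  have ea: "e * a = a * e" and fp: "f * p = p * f" and fb: "f * b = b * f"
    unfolding e_def f_def using ap qp qb by (simp_all add: commute_one_minus)
  have pe: "p * e = 0" "e * p = 0" unfolding e_def using p by (simp_all add: algebra_simps)
  have ep0: "e * (p * z) = 0" for z by (simp add: pe flip: mult.assoc)
  \<comment> \<open>As rewrite rules, these move \<open>p\<close> to the right until it meets \<open>e\<close>.\<close>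
  note to_right = ap[symmetric] bp[symmetric] fp[symmetric]
  note to_right = to_right to_right[THEN commute_imp_left_commute]
  define c where "c = a * (b * e)"
  define d where "d = (p * b) * (a * f)"
  have "powers_decay c"
    unfolding c_def
    by (rule powers_decay_mult[OF decay(2)[folded e_def] commute_mult[OF ab[symmetric] ea, symmetric]])
  moreover have "powers_decay d"
  proof -
    have "a * f * p = p * (a * f)" "a * f * b = b * (a * f)"
      using commute_mult ap fp ab fb by metis+
    then show ?thesis
      unfolding d_def
      by (intro powers_decay_mult[OF decay(1)[folded f_def]] commute_mult) (rule sym, assumption)+
  qed
  moreover have "c * d = 0"
    unfolding c_def d_def by (simp add: mult.assoc ep0)
  moreover have "d * c = 0"
    unfolding c_def d_def by (simp add: mult.assoc to_right pe)
  ultimately have "powers_decay (- (c + d))"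
    by (intro powers_decay_uminus powers_decay_add_orthogonal)
  moreover have "a * b * (p * q) - a * b = - (c + d)"
  proof -
    have "d = b * a * (p * f)" unfolding d_def by (simp only: mult.assoc to_right)
    then show ?thesis unfolding c_def ab[symmetric] by (simp add: e_def f_def algebra_simps)
  qed
  ultimately show ?thesis by (simp add: qnil_iff_powers_decay)
qed

lemma left_inverse_projection:
  fixes b y :: "'a::monoid_mult"
  assumes "b * y * b = y * b ^ 2" "y ^ 2 * b = y"
  shows "(y * b) * (y * b) = y * b" "b * (y * b) = (y * b) * b" "y * (y * b) = y"
  using assms unfolding power2_eq_square by (metis mult.assoc)+

lemma right_inverse_projection:
  fixes b y :: "'a::monoid_mult"
  assumes "b * y * b = b ^ 2 * y" "b * y ^ 2 = y"
  shows "(b * y) * (b * y) = b * y" "b * (b * y) = (b * y) * b" "(b * y) * y = y"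
  using assms unfolding power2_eq_square by (metis mult.assoc)+

text \<open>
  Since \<open>y\<close> need not commute with \<open>a\<close> or \<open>b\<close>, the identities rest on \<open>a\<close> and \<open>x\<close> commuting with
  \<open>b\<close> and with \<open>y b\<close>: both lie in the double commutant of \<open>b\<close>, and \<open>b\<close> commutes with \<open>y b\<close>.
\<close>

lemma left_inverse_mult:
  fixes a b x y :: "'a::complex_banach_algebra_1"
  assumes a: "a \<in> comm2 b" and x: "is_gen_drazin_inverse a x"
    and y: "b * y * b = y * b ^ 2" "y ^ 2 * b = y"
  shows "(a * b) * (y * x) * (a * b) = (y * x) * (a * b) ^ 2"
    and "(y * x) ^ 2 * (a * b) = y * x"
    and "(a * b) * (y * x) * (a * b) = a * b * ((y * b) * (a * x))"
    and "a * b = b * a" "x * b = b * x" "a * (y * b) = (y * b) * a" "x * (y * b) = (y * b) * x"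
proof -
  note P = left_inverse_projection[OF y]
  have x2: "x \<in> comm2 b" using comm2_trans[OF a gen_drazin_inverse_in_comm2[OF x]] .
  have "b \<in> comm b" "y * b \<in> comm b" using P(2) unfolding comm_def by auto
  then show c: "a * b = b * a" "x * b = b * x" "a * (y * b) = (y * b) * a" "x * (y * b) = (y * b) * x"
    using a x2 unfolding comm2_def by auto
  have ax: "a * x = x * a" using x unfolding is_gen_drazin_inverse_def by simp
  note Q = drazin_projection[OF x]
  define p where "p = y * b"
  have yb: "y * (b * z) = p * z" and yp: "y * (p * z) = y * z" for z
    using P(3) unfolding p_def by (metis mult.assoc)+
  have axx: "a * (x * x) = x" using Q(4) by (simp add: mult.assoc)
  \<comment> \<open>Normal form: \<open>b\<close> moves left until \<open>y\<close> absorbs it into \<open>p\<close>, while \<open>a\<close> and \<open>x\<close> move right.\<close>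
  note normal = c[folded p_def] P(2)[folded p_def] ax[symmetric]
  note normal = normal normal[THEN commute_imp_left_commute] p_def[symmetric] yb yp axx
  show "(a * b) * (y * x) * (a * b) = a * b * ((y * b) * (a * x))"
    "(a * b) * (y * x) * (a * b) = (y * x) * (a * b) ^ 2"
    "(y * x) ^ 2 * (a * b) = y * x"
    by (simp_all only: power2_eq_square mult.assoc normal)
qed

text \<open>
  The mirror image of \<open>left_inverse_mult\<close>: now \<open>b y\<close> is the idempotent that commutes with \<open>b\<close>, and
  \<open>x\<close> stands to the left of \<open>y\<close>.
\<close>

lemma right_inverse_mult:
  fixes a b x y :: "'a::complex_banach_algebra_1"
  assumes a: "a \<in> comm2 b" and x: "is_gen_drazin_inverse a x"
    and y: "b * y * b = b ^ 2 * y" "b * y ^ 2 = y"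
  shows "(a * b) * (x * y) * (a * b) = (a * b) ^ 2 * (x * y)"
    and "(a * b) * (x * y) ^ 2 = x * y"
    and "(a * b) * (x * y) * (a * b) = a * b * ((b * y) * (a * x))"
    and "a * b = b * a" "x * b = b * x" "a * (b * y) = (b * y) * a" "x * (b * y) = (b * y) * x"
proof -
  note P = right_inverse_projection[OF y]
  have x2: "x \<in> comm2 b" using comm2_trans[OF a gen_drazin_inverse_in_comm2[OF x]] .
  have "b \<in> comm b" "b * y \<in> comm b" using P(2) unfolding comm_def by auto
  then show c: "a * b = b * a" "x * b = b * x" "a * (b * y) = (b * y) * a" "x * (b * y) = (b * y) * x"
    using a x2 unfolding comm2_def by auto
  have ax: "a * x = x * a" using x unfolding is_gen_drazin_inverse_def by simp
  note Q = drazin_projection[OF x]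
  define p where "p = b * y"
  have b_y: "b * (y * z) = p * z" and py: "p * y = y" for z
    using P(3) unfolding p_def by (metis mult.assoc)+
  have axx: "a * (x * (x * z)) = x * z" for z using Q(4) by (metis mult.assoc)
  \<comment> \<open>Normal form: \<open>a\<close> and \<open>x\<close> move left, so that \<open>b\<close> meets \<open>y\<close> and forms \<open>p\<close>.\<close>
  note normal = c[folded p_def, symmetric] P(2)[folded p_def] ax[symmetric]
  note normal = normal normal[THEN commute_imp_left_commute] p_def[symmetric] b_y py axx
  show "(a * b) * (x * y) * (a * b) = a * b * ((b * y) * (a * x))"
    "(a * b) * (x * y) * (a * b) = (a * b) ^ 2 * (x * y)"
    "(a * b) * (x * y) ^ 2 = x * y"
    by (simp_all only: power2_eq_square mult.assoc normal)
qed

lemma left_power_absorb: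
  fixes c x :: "'a::monoid_mult"
  assumes "x * c ^ (j + 1) = c ^ j" "j \<le> n"
  shows "x * c ^ (n + 1) = c ^ n"
proof -
  have "c ^ (n + 1) = c ^ (j + 1) * c ^ (n - j)" "c ^ n = c ^ j * c ^ (n - j)"
    using assms(2) by (simp_all del: power_Suc flip: power_add)
  then show ?thesis using assms(1) by (metis mult.assoc)
qed

lemma right_power_absorb:
  fixes c x :: "'a::monoid_mult"
  assumes "c ^ (j + 1) * x = c ^ j" "j \<le> n"
  shows "c ^ (n + 1) * x = c ^ n"
proof -
  have "c ^ (n + 1) = c ^ (n - j) * c ^ (j + 1)" "c ^ n = c ^ (n - j) * c ^ j"
    using assms(2) by (simp_all del: power_Suc flip: power_add)
  then show ?thesis using assms(1) by (metis mult.assoc)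
qed

lemma left_drazin_inverse_mult:
  assumes a: "a \<in> comm2 b" and x: "is_drazin_inverse a x" and y: "is_left_drazin_inverse b y"
  shows "is_left_drazin_inverse (a * b) (y * x)"
proof -
  obtain i where i: "a ^ (i + 1) * x = a ^ i" and ax: "a * x = x * a"
    using x unfolding is_drazin_inverse_def by blast
  obtain j where j: "y * b ^ (j + 1) = b ^ j"
    and y': "b * y * b = y * b ^ 2" "y ^ 2 * b = y"
    using y unfolding is_left_drazin_inverse_def by blast
  note F = left_inverse_mult[OF a gen_drazin_inverse_if_drazin_inverse[OF x] y']
  define n where "n = max i j"
  have "(y * x) * (a * b) ^ (n + 1) = y * x * (b ^ (n + 1) * a ^ (n + 1))"
    using power_mult_distrib_commuting[OF F(4)[symmetric]] F(4) by metis
  also have "\<dots> = (y * b ^ (n + 1)) * (x * a ^ (n + 1))"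
    using power_commuting_commutes[OF F(5)[symmetric]] by (metis mult.assoc)
  also have "y * b ^ (n + 1) = b ^ n" using left_power_absorb[OF j] n_def by simp
  also have "x * a ^ (n + 1) = a ^ n"
    using right_power_absorb[OF i, of n] power_commuting_commutes[OF ax, of "n + 1"] n_def by simp
  also have "b ^ n * a ^ n = (a * b) ^ n"
    using power_mult_distrib_commuting[OF F(4)[symmetric]] F(4) by metis
  finally show ?thesis using F(1,2) unfolding is_left_drazin_inverse_def by blast
qed

lemma right_drazin_inverse_mult:
  assumes a: "a \<in> comm2 b" and x: "is_drazin_inverse a x" and y: "is_right_drazin_inverse b y"
  shows "is_right_drazin_inverse (a * b) (x * y)"
proof -
  obtain i where i: "a ^ (i + 1) * x = a ^ i"
    using x unfolding is_drazin_inverse_def by blast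
  obtain j where j: "b ^ (j + 1) * y = b ^ j"
    and y': "b * y * b = b ^ 2 * y" "b * y ^ 2 = y"
    using y unfolding is_right_drazin_inverse_def by blast
  note F = right_inverse_mult[OF a gen_drazin_inverse_if_drazin_inverse[OF x] y']
  define n where "n = max i j"
  have "(a * b) ^ (n + 1) * (x * y) = a ^ (n + 1) * b ^ (n + 1) * (x * y)"
    using power_mult_distrib_commuting[OF F(4)] by metis
  also have "\<dots> = (a ^ (n + 1) * x) * (b ^ (n + 1) * y)"
    using power_commuting_commutes[OF F(5)[symmetric]] by (metis mult.assoc)
  also have "a ^ (n + 1) * x = a ^ n" using right_power_absorb[OF i] n_def by simp
  also have "b ^ (n + 1) * y = b ^ n" using right_power_absorb[OF j] n_def by simp
  also have "a ^ n * b ^ n = (a * b) ^ n"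
    using power_mult_distrib_commuting[OF F(4)] by metis
  finally show ?thesis using F(1,2) unfolding is_right_drazin_inverse_def by blast
qed

lemma left_gen_drazin_inverse_mult:
  assumes a: "a \<in> comm2 b" and x: "is_gen_drazin_inverse a x" and y: "is_left_gen_drazin_inverse b y"
  shows "is_left_gen_drazin_inverse (a * b) (y * x)"
proof -
  have y': "b * y * b = y * b ^ 2" "y ^ 2 * b = y" and q: "b * y * b - b \<in> qnil"
    using y unfolding is_left_gen_drazin_inverse_def by auto
  note F = left_inverse_mult[OF a x y']
  note P = left_inverse_projection[OF y']
  note Q = drazin_projection[OF x]
  have "powers_decay (b * (1 - y * b))"
    using powers_decay_uminus[OF q[unfolded qnil_iff_powers_decay]] by (simp add: algebra_simps)
  then have "a * b * ((y * b) * (a * x)) - a * b \<in> qnil"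
    by (rule qnil_mult_one_minus_projections[OF Q(5) _ P(1) F(4) F(6) P(2)
          commute_mult[OF F(4,5)] commute_mult[OF F(6,7)] Q(2)[symmetric]])
  then show ?thesis using F(1-3) unfolding is_left_gen_drazin_inverse_def by simp
qed

lemma right_gen_drazin_inverse_mult:
  assumes a: "a \<in> comm2 b" and x: "is_gen_drazin_inverse a x" and y: "is_right_gen_drazin_inverse b y"
  shows "is_right_gen_drazin_inverse (a * b) (x * y)"
proof -
  have y': "b * y * b = b ^ 2 * y" "b * y ^ 2 = y" and q: "b * y * b - b \<in> qnil"
    using y unfolding is_right_gen_drazin_inverse_def by auto
  note F = right_inverse_mult[OF a x y']
  note P = right_inverse_projection[OF y']
  note Q = drazin_projection[OF x]
  have "b * (1 - b * y) = - (b * y * b - b)" using P(2) by (simp add: algebra_simps)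
  then have "powers_decay (b * (1 - b * y))"
    using powers_decay_uminus[OF q[unfolded qnil_iff_powers_decay]] by simp
  then have "a * b * ((b * y) * (a * x)) - a * b \<in> qnil"
    by (rule qnil_mult_one_minus_projections[OF Q(5) _ P(1) F(4) F(6) P(2)
          commute_mult[OF F(4,5)] commute_mult[OF F(6,7)] Q(2)[symmetric]])
  then show ?thesis using F(1-3) unfolding is_right_gen_drazin_inverse_def by simp
qed

theorem theorem2p4:
  fixes a b :: "'a::complex_banach_algebra_1"
  assumes "a \<in> comm2 b"
  shows "(\<forall>x y. is_drazin_inverse a x \<and> is_left_drazin_inverse b y
             \<longrightarrow> is_left_drazin_inverse (a * b) (y * x)) \<and>
         (\<forall>x y. is_drazin_inverse a x \<and> is_right_drazin_inverse b y
             \<longrightarrow> is_right_drazin_inverse (a * b) (x * y)) \<and>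
         (\<forall>x y. is_gen_drazin_inverse a x \<and> is_left_gen_drazin_inverse b y
             \<longrightarrow> is_left_gen_drazin_inverse (a * b) (y * x)) \<and>
         (\<forall>x y. is_gen_drazin_inverse a x \<and> is_right_gen_drazin_inverse b y
             \<longrightarrow> is_right_gen_drazin_inverse (a * b) (x * y))"
  using assms by (blast intro: left_drazin_inverse_mult right_drazin_inverse_mult
      left_gen_drazin_inverse_mult right_gen_drazin_inverse_mult)

end
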